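(* Let $k \geq 1$ be an integer. A real sequence $(c_n)_{n \in \mathbb{Z}}$ is a $TP_k$ Pólya frequency sequence if and only if for all integers $r \in \{1,\ldots,k\}$ and $l \in \mathbb{Z}$, and all vectors $q \in \mathbb{R}^{r}$ with $q<0$ (every coordinate negative), there exists a unique $x \in [0,\infty)^r$ such that $$y_i:=\sum_{j=1}^r c_{l + i - j}\, x_j +q_i\geq 0 \quad\text{and}\quad x_i y_i=0\qquad \text{for all } i \in \{1,\ldots,r\}.$$
   Context: A real sequence $(c_n)_{n\in\mathbb{Z}}$ is a $TP_k$ Pólya frequency sequence if for all integers $1\le r\le k$, $m_1<\cdots<m_r$ and $n_1<\cdots<n_r$, the determinant $\det(c_{m_i-n_j})_{i,j=1}^r$ is positive. *)

theory Defs
  imports Complex_Main "HOL-Library.FuncSet" "Jordan_Normal_Form.Determinant"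
begin

(* The two index tuples are functions on {..<r}, matching the 0-based matrix indices;
   their values outside {..<r} are irrelevant. *)
definition TP_Polya_frequency_seq :: "nat \<Rightarrow> (int \<Rightarrow> real) \<Rightarrow> bool" where
  "TP_Polya_frequency_seq k c \<longleftrightarrow>
     (\<forall>r \<in> {1..k}. \<forall>m n :: nat \<Rightarrow> int.
        strict_mono_on {..<r} m \<longrightarrow> strict_mono_on {..<r} n \<longrightarrow>
        Determinant.det (mat r r (\<lambda>(i, j). c (m i - n j))) > 0)"

end

theory Submission
  imports Defs
begin

text \<open>If \<open>c\<close> is \<open>TP\<^sub>k\<close>, the principal minors of the Toeplitz matrices are positive, so these
  matrices reverse the signs of no nonzero vector. This property makes solutions of the
  complementarity problem unique, and it passes to submatrices and Schur complements, which yields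
  existence by induction.

  Conversely, unique solvability for \<open>r = 1\<close> makes all entries positive. Inductively, if all minors
  of order \<open>r - 1\<close> are positive and some contiguous minor of order \<open>r\<close> is not, the adjugate produces
  two solutions of one complementarity problem. Hence all contiguous minors of order \<open>r\<close> are
  positive, and Fekete's argument extends this to all minors of order \<open>r\<close>.\<close>

subsection \<open>Minors and row relations\<close>

text \<open>Index functions in place of matrices turn passing to a submatrix into composition with
  index maps.\<close>

definition mdet :: "nat \<Rightarrow> (nat \<Rightarrow> nat \<Rightarrow> real) \<Rightarrow> real" where
  "mdet n f = Determinant.det (mat n n (\<lambda>(i, j). f i j))"

lemma mdet_cong:
  assumes "\<And>i j. i < n \<Longrightarrow> j < n \<Longrightarrow> f i j = g i j"
  shows "mdet n f = mdet n g"
proof -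
  have "mat n n (\<lambda>(i, j). f i j) = mat n n (\<lambda>(i, j). g i j)"
    by (rule eq_matI) (auto simp: assms)
  then show ?thesis by (simp add: mdet_def)
qed

lemma mdet_0 [simp]: "mdet 0 f = 1"
  by (simp add: mdet_def)

lemma mdet_1: "mdet (Suc 0) f = f 0 0"
  unfolding mdet_def by (subst det_single) auto

lemma mdet_transpose: "mdet n (\<lambda>i j. f j i) = mdet n f"
proof -
  have "mat n n (\<lambda>(i, j). f j i) = transpose_mat (mat n n (\<lambda>(i, j). f i j))"
    by (rule eq_matI) auto
  then show ?thesis unfolding mdet_def by (simp add: det_transpose[of _ n])
qed

lemma cofactor_mat:
  assumes "i < n" "j < n"
  shows "cofactor (mat n n (\<lambda>(i, j). f i j)) i j =
    (-1) ^ (i + j) * mdet (n - 1) (\<lambda>i' j'. f (insert_index i i') (insert_index j j'))"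
proof -
  have "mat_delete (mat n n (\<lambda>(i, j). f i j)) i j =
    mat (n - 1) (n - 1) (\<lambda>(i', j'). f (insert_index i i') (insert_index j j'))"
    using assms by (intro eq_matI) (auto simp: mat_delete_def insert_index_def)
  then show ?thesis by (simp add: cofactor_def mdet_def)
qed

lemma mdet_expand_row:
  assumes "p < n"
  shows "mdet n f = (\<Sum>j<n. f p j * ((-1) ^ (p + j) *
    mdet (n - 1) (\<lambda>i' j'. f (insert_index p i') (insert_index j j'))))"
  unfolding mdet_def[of n]
  by (subst laplace_expansion_row[of _ n p])
    (use assms in \<open>auto simp: cofactor_mat intro!: sum.cong\<close>)

lemma mdet_expand_column:
  assumes "p < n"
  shows "mdet n f = (\<Sum>i<n. f i p * ((-1) ^ (i + p) *
    mdet (n - 1) (\<lambda>i' j'. f (insert_index i i') (insert_index p j'))))"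
  unfolding mdet_def[of n]
  by (subst laplace_expansion_column[of _ n p])
    (use assms in \<open>auto simp: cofactor_mat intro!: sum.cong\<close>)

lemma mdet_adjugate:
  assumes "i < n" "k < n"
  shows "(\<Sum>j<n. f i j * ((-1) ^ (k + j) *
    mdet (n - 1) (\<lambda>i' j'. f (insert_index k i') (insert_index j j')))) =
    (if i = k then mdet n f else 0)"
proof -
  let ?A = "mat n n (\<lambda>(i, j). f i j)"
  have A: "?A \<in> carrier_mat n n" by simp
  have "(?A * adj_mat ?A) $$ (i, k) = (Determinant.det ?A \<cdot>\<^sub>m 1\<^sub>m n) $$ (i, k)"
    using adj_mat(2)[OF A] by simp
  moreover have "(?A * adj_mat ?A) $$ (i, k) = (\<Sum>j<n. f i j * ((-1) ^ (k + j) *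
      mdet (n - 1) (\<lambda>i' j'. f (insert_index k i') (insert_index j j'))))"
    using assms
    by (auto simp: adj_mat_def scalar_prod_def cofactor_mat atLeast0LessThan intro!: sum.cong)
  ultimately show ?thesis using assms by (simp add: mdet_def)
qed

lemma mdet_nonzero_kernel:
  assumes "mdet n f \<noteq> 0" and "\<And>i. i < n \<Longrightarrow> (\<Sum>j<n. f i j * z j) = 0" and "i < n"
  shows "z i = 0"
proof -
  let ?A = "mat n n (\<lambda>(i, j). f i j)"
  have "?A *\<^sub>v vec n z = 0\<^sub>v n"
    using assms(2) by (intro eq_vecI) (auto simp: scalar_prod_def atLeast0LessThan)
  then have "vec n z = 0\<^sub>v n"
    using det_0_iff_vec_prod_zero[of ?A n] assms(1) vec_carrier[of n z]
    unfolding mdet_def by (metis mat_carrier)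
  then show ?thesis using \<open>i < n\<close> by (metis index_vec index_zero_vec(1))
qed

text \<open>Put a copy of column \<open>j\<close> in front of the \<open>n\<close> columns: the
  square matrix obtained has two equal columns, and expanding its zero determinant along the copy
  gives the relation.\<close>

lemma row_deletion_relation:
  assumes "j < n"
  shows "(\<Sum>i<Suc n. (-1) ^ i * mdet n (\<lambda>i' j'. f (insert_index i i') j') * f i j) = 0"
proof -
  define g where "g = (\<lambda>i j'. if j' = 0 then f i j else f i (j' - 1))"
  let ?A = "mat (Suc n) (Suc n) (\<lambda>(i, j). g i j)"
  have "mdet (Suc n) g = 0"
    unfolding mdet_def
  proof (rule det_identical_columns[of _ "Suc n" 0 "Suc j"])
    show "col ?A 0 = col ?A (Suc j)"
      using assms by (intro eq_vecI) (auto simp: g_def)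
  qed (use assms in auto)
  then have "0 = (\<Sum>i<Suc n. g i 0 * ((-1) ^ (i + 0) *
    mdet (Suc n - 1) (\<lambda>i' j'. g (insert_index i i') (insert_index 0 j'))))"
    using mdet_expand_column[of 0 "Suc n" g] by simp
  also have "\<dots> = (\<Sum>i<Suc n. (-1) ^ i * mdet n (\<lambda>i' j'. f (insert_index i i') j') * f i j)"
    by (intro sum.cong) (auto simp: g_def)
  finally show ?thesis by simp
qed

text \<open>The rows \<open>0, \<dots>, n + 1\<close> satisfy a linear relation whose coefficients are the alternating
  maximal minors. Restricted to the first \<open>n\<close> columns it is a combination of the two analogous
  relations omitting row \<open>0\<close> and row \<open>n + 1\<close>; comparing coefficients gives a three-term
  identity without any negative term.\<close>

lemma minor_between_positive:
  fixes f :: "nat \<Rightarrow> nat \<Rightarrow> real"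
  assumes sub: "\<And>s. strict_mono_on {..<n} s \<Longrightarrow> s ` {..<n} \<subseteq> {..n + 1} \<Longrightarrow>
      0 < mdet n (\<lambda>i j. f (s i) j)"
    and first: "0 < mdet (Suc n) (\<lambda>i j. f (insert_index 0 i) j)"
    and last: "0 < mdet (Suc n) (\<lambda>i j. f (insert_index (Suc n) i) j)"
    and t: "0 < t" "t \<le> n"
  shows "0 < mdet (Suc n) (\<lambda>i j. f (insert_index t i) j)"
proof -
  define D where "D i = mdet (Suc n) (\<lambda>i' j. f (insert_index i i') j)" for i
  \<comment> \<open>\<open>E p i\<close> omits row \<open>p\<close> and then the \<open>i\<close>-th
    remaining row. So \<open>E (Suc n)\<close> gives the relation among rows
    \<open>0, ..., n\<close>, and \<open>E 0\<close> the one among rows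
    \<open>1, ..., n + 1\<close>, where \<open>i\<close> stands for row
    \<open>i + 1\<close>.\<close>
  define E where "E p i = mdet n (\<lambda>i' j. f (insert_index p (insert_index i i')) j)" for p i
  have E_pos: "0 < E p i" if "p \<le> Suc n" "i \<le> n" for p i
  proof -
    have "strict_mono_on {..<n} (\<lambda>i'. insert_index p (insert_index i i'))"
      by (auto simp: strict_mono_on_def insert_index_def)
    moreover have "(\<lambda>i'. insert_index p (insert_index i i')) ` {..<n} \<subseteq> {..n + 1}"
      by (auto simp: insert_index_def)
    ultimately show ?thesis unfolding E_def by (rule sub)
  qed
  define e where "e = E (Suc n) 0"
  have e': "E 0 n = e"
    unfolding e_def E_def by (rule mdet_cong) (auto simp: insert_index_def)
  have e_pos: "0 < e" unfolding e_def by (rule E_pos) auto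
  \<comment> \<open>The weights \<open>e\<close>, \<open>D 0\<close> and \<open>D (Suc n)\<close>
    make the coefficients at rows \<open>0\<close> and \<open>Suc n\<close> cancel. The other
    coefficients form a relation among rows \<open>1, ..., n\<close>, whose minor is
    \<open>e > 0\<close>, so they vanish.\<close>
  define v where "v i = e * ((-1) ^ i * D i) - (if i \<le> n then D 0 * ((-1) ^ i * E (Suc n) i) else 0)
      + (if 0 < i then D (Suc n) * ((-1) ^ (i - 1) * E 0 (i - 1)) else 0)" for i
  have rD: "(\<Sum>i<Suc (Suc n). (-1) ^ i * D i * f i j) = 0" if "j < n" for j
    using row_deletion_relation[of j "Suc n" f] that unfolding D_def by simp
  have rL: "(\<Sum>i<Suc n. (-1) ^ i * E (Suc n) i * f i j) = 0" if "j < n" for j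
  proof -
    have "(\<Sum>i<Suc n. (-1) ^ i * E (Suc n) i * f i j) =
      (\<Sum>i<Suc n. (-1) ^ i * E (Suc n) i * f (insert_index (Suc n) i) j)"
      by (intro sum.cong) auto
    then show ?thesis
      using row_deletion_relation[of j n "\<lambda>i. f (insert_index (Suc n) i)"] that
      unfolding E_def by simp
  qed
  have rF: "(\<Sum>i<Suc n. (-1) ^ i * E 0 i * f (Suc i) j) = 0" if "j < n" for j
    using row_deletion_relation[of j n "\<lambda>i. f (insert_index 0 i)"] that
    unfolding E_def by simp
  have v0: "v 0 = 0" by (simp add: v_def e_def)
  have vn: "v (Suc n) = 0" by (simp add: v_def e')
  have v_kernel: "(\<Sum>i<n. f (Suc i) j * v (Suc i)) = 0" if j: "j < n" for j
  proof -
    have "(\<Sum>i<Suc (Suc n). v i * f i j) =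
      e * (\<Sum>i<Suc (Suc n). (-1) ^ i * D i * f i j)
      - D 0 * (\<Sum>i<Suc (Suc n). if i \<le> n then (-1) ^ i * E (Suc n) i * f i j else 0)
      + D (Suc n) * (\<Sum>i<Suc (Suc n). if 0 < i then (-1) ^ (i - 1) * E 0 (i - 1) * f i j else 0)"
      unfolding sum_distrib_left sum_subtractf[symmetric] sum.distrib[symmetric]
      by (intro sum.cong refl) (auto simp: v_def algebra_simps)
    also have "(\<Sum>i<Suc (Suc n). if i \<le> n then (-1) ^ i * E (Suc n) i * f i j else 0) =
      (\<Sum>i<Suc n. (-1) ^ i * E (Suc n) i * f i j)"
      by (subst sum.lessThan_Suc) (auto intro!: sum.cong)
    also have "(\<Sum>i<Suc (Suc n). if 0 < i then (-1) ^ (i - 1) * E 0 (i - 1) * f i j else 0) =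
      (\<Sum>i<Suc n. (-1) ^ i * E 0 i * f (Suc i) j)"
      by (subst sum.lessThan_Suc_shift) simp
    finally have "(\<Sum>i<Suc (Suc n). v i * f i j) = 0"
      by (simp only: rD[OF j] rL[OF j] rF[OF j])
    then show ?thesis
      by (subst (asm) sum.lessThan_Suc_shift) (simp add: v0 vn mult.commute)
  qed
  have "v (Suc (t - 1)) = 0"
  proof (rule mdet_nonzero_kernel[of n "\<lambda>j i. f (Suc i) j" "\<lambda>i. v (Suc i)"])
    have "mdet n (\<lambda>i j. f (Suc i) j) = e"
      unfolding e_def E_def by (rule mdet_cong) (auto simp: insert_index_def)
    then show "mdet n (\<lambda>j i. f (Suc i) j) \<noteq> 0"
      using e_pos mdet_transpose[of n "\<lambda>i j. f (Suc i) j"] by simp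
  qed (use v_kernel t in auto)
  \<comment> \<open>The offset in \<open>E 0 (t - 1)\<close> contributes one extra sign, which makes
    both terms on the right positive.\<close>
  then have "(-1) ^ t * (e * D t) = (-1) ^ t * (D 0 * E (Suc n) t + D (Suc n) * E 0 (t - 1))"
    using t by (cases t) (auto simp: v_def algebra_simps)
  then have "e * D t = D 0 * E (Suc n) t + D (Suc n) * E 0 (t - 1)"
    by simp
  also have "\<dots> > 0"
    using first last t E_pos[of "Suc n" t] E_pos[of 0 "t - 1"]
    by (intro add_pos_pos mult_pos_pos) (auto simp: D_def)
  finally show ?thesis
    using e_pos by (simp add: D_def zero_less_mult_iff)
qed

subsection \<open>Fekete's criterion\<close>

lemma strict_mono_on_gap:
  fixes m :: "nat \<Rightarrow> int"
  assumes "strict_mono_on {..<Suc n} m"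
    and "\<not> (\<forall>i\<le>n. m i = m 0 + int i)"
  obtains t where "0 < t" "t \<le> n" "m (t - 1) + 1 < m t"
proof -
  have "\<exists>t. 0 < t \<and> t \<le> n \<and> m (t - 1) + 1 < m t"
  proof (rule ccontr)
    assume no: "\<not> ?thesis"
    have "m i = m 0 + int i" if "i \<le> n" for i
      using that
    proof (induction i)
      case (Suc i)
      have "m i < m (Suc i)"
        using assms(1) Suc.prems by (auto simp: strict_mono_on_def)
      moreover have "\<not> m i + 1 < m (Suc i)" using no Suc.prems by force
      ultimately show ?case using Suc by simp
    qed simp
    then show False using assms(2) by blast
  qed
  then show ?thesis using that by blast
qed

text \<open>Induction on the spread \<open>m n - m 0\<close>. If the rows are not contiguous, put a
  new row into a gap. Dropping the first or the last of the \<open>n + 2\<close> rows decreases the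
  spread, and \<open>minor_between_positive\<close> then treats the removal of the new row.\<close>

lemma minors_positive_of_contiguous_rows:
  fixes g :: "int \<Rightarrow> nat \<Rightarrow> real"
  assumes sub: "\<And>m. strict_mono_on {..<n} m \<Longrightarrow> 0 < mdet n (\<lambda>i j. g (m i) j)"
    and contig: "\<And>a. 0 < mdet (Suc n) (\<lambda>i j. g (a + int i) j)"
    and m: "strict_mono_on {..<Suc n} m"
  shows "0 < mdet (Suc n) (\<lambda>i j. g (m i) j)"
  using m
proof (induction "nat (m n - m 0)" arbitrary: m rule: less_induct)
  case less
  show ?case
  proof (cases "\<forall>i\<le>n. m i = m 0 + int i")
    case True
    then have "mdet (Suc n) (\<lambda>i j. g (m i) j) = mdet (Suc n) (\<lambda>i j. g (m 0 + int i) j)"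
      by (intro mdet_cong) (metis less_Suc_eq_le)
    then show ?thesis using contig by simp
  next
    case False
    obtain t where t: "0 < t" "t \<le> n" "m (t - 1) + 1 < m t"
      using strict_mono_on_gap[OF less.prems False] by blast
    have mono: "m i < m j" if "i < j" "j \<le> n" for i j
      using less.prems that by (auto simp: strict_mono_on_def)
    have mono_le: "m i \<le> m j" if "i \<le> j" "j \<le> n" for i j
      using mono[of i j] that by (cases "i = j") auto
    \<comment> \<open>\<open>w\<close> is \<open>m\<close> with \<open>m (t - 1) + 1\<close>
      inserted at position \<open>t\<close>.\<close>
    define w where "w i = (if i < t then m i else if i = t then m (t - 1) + 1 else m (i - 1))" for i
    have w_step: "w i < w (Suc i)" if "i \<le> n" for i
    proof -
      consider "Suc i < t" | "Suc i = t" | "i = t" | "t < i" by linarith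
      then show ?thesis
      proof cases
        case 4
        then show ?thesis using mono[of "i - 1" i] that by (auto simp: w_def)
      qed (use mono[of i "Suc i"] t that in \<open>auto simp: w_def\<close>)
    qed
    have w_mono: "w i < w j" if "i < j" "j \<le> Suc n" for i j
      using that
    proof (induction j)
      case (Suc j)
      then show ?case using w_step[of j] by (cases "i = j") auto
    qed simp
    have "0 < mdet (Suc n) (\<lambda>i j. g (w (insert_index t i)) j)"
    proof (rule minor_between_positive[where f = "\<lambda>i. g (w i)", OF _ _ _ t(1,2)])
      fix s :: "nat \<Rightarrow> nat"
      assume s: "strict_mono_on {..<n} s" "s ` {..<n} \<subseteq> {..n + 1}"
      have "strict_mono_on {..<n} (\<lambda>i. w (s i))"
        using s w_mono by (auto simp: strict_mono_on_def image_subset_iff)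
      then show "0 < mdet n (\<lambda>i j. g (w (s i)) j)" by (rule sub)
    next
      have "m 0 < w (Suc 0)" "w (Suc n) \<le> m n"
        using w_mono[of 0 "Suc 0"] t by (auto simp: w_def)
      then have "w (insert_index 0 n) - w (insert_index 0 0) < m n - m 0" by simp
      moreover have "0 < m n - m 0" using mono[of 0 n] t by simp
      ultimately show "0 < mdet (Suc n) (\<lambda>i j. g (w (insert_index 0 i)) j)"
        by (intro less.hyps) (auto simp: strict_mono_on_def w_mono)
    next
      have "w 0 = m 0" "w n < m n"
        using w_mono[of n "Suc n"] t by (auto simp: w_def)
      then have "w (insert_index (Suc n) n) - w (insert_index (Suc n) 0) < m n - m 0" by simp
      moreover have "0 < m n - m 0" using mono[of 0 n] t by simp
      ultimately show "0 < mdet (Suc n) (\<lambda>i j. g (w (insert_index (Suc n) i)) j)"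
        by (intro less.hyps) (auto simp: strict_mono_on_def w_mono)
    qed
    moreover have "w (insert_index t i) = m i" for i
      by (auto simp: w_def insert_index_def)
    ultimately show ?thesis by simp
  qed
qed

text \<open>The rows are freed first, over contiguous columns; then the columns, over the arbitrary
  rows, by transposition.\<close>

lemma Fekete_step:
  fixes g :: "int \<Rightarrow> int \<Rightarrow> real"
  assumes sub: "\<And>m l. strict_mono_on {..<n} m \<Longrightarrow> strict_mono_on {..<n} l \<Longrightarrow>
      0 < mdet n (\<lambda>i j. g (m i) (l j))"
    and contig: "\<And>a b. 0 < mdet (Suc n) (\<lambda>i j. g (a + int i) (b + int j))"
    and m: "strict_mono_on {..<Suc n} m" and l: "strict_mono_on {..<Suc n} l"
  shows "0 < mdet (Suc n) (\<lambda>i j. g (m i) (l j))"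
proof -
  have rows: "0 < mdet (Suc n) (\<lambda>i j. g (m i) (b + int j))" for b
    by (rule minors_positive_of_contiguous_rows[where g = "\<lambda>x j. g x (b + int j)", OF _ contig m])
      (auto intro!: sub simp: strict_mono_on_def)
  have "0 < mdet (Suc n) (\<lambda>j i. g (m i) (l j))"
  proof (rule minors_positive_of_contiguous_rows[where g = "\<lambda>y i. g (m i) y", OF _ _ l])
    fix l' :: "nat \<Rightarrow> int"
    assume "strict_mono_on {..<n} l'"
    then have "0 < mdet n (\<lambda>i j. g (m i) (l' j))"
      using m by (intro sub) (auto simp: strict_mono_on_def)
    then show "0 < mdet n (\<lambda>j i. g (m i) (l' j))"
      using mdet_transpose[of n "\<lambda>i j. g (m i) (l' j)"] by simp
  next
    fix b
    show "0 < mdet (Suc n) (\<lambda>j i. g (m i) (b + int j))"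
      using rows[of b] mdet_transpose[of "Suc n" "\<lambda>i j. g (m i) (b + int j)"] by simp
  qed
  then show ?thesis
    using mdet_transpose[of "Suc n" "\<lambda>i j. g (m i) (l j)"] by simp
qed

subsection \<open>Positive principal minors and sign reversal\<close>

text \<open>These are the P-matrices.\<close>

definition principal_minors_positive :: "nat \<Rightarrow> (nat \<Rightarrow> nat \<Rightarrow> real) \<Rightarrow> bool" where
  "principal_minors_positive n f \<longleftrightarrow>
    (\<forall>r s. strict_mono_on {..<r} s \<longrightarrow> s ` {..<r} \<subseteq> {..<n} \<longrightarrow> 0 < mdet r (\<lambda>i j. f (s i) (s j)))"

lemma principal_minors_positive_delete:
  assumes "principal_minors_positive (Suc n) f"
  shows "principal_minors_positive n (\<lambda>i j. f (insert_index p i) (insert_index p j))"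
  unfolding principal_minors_positive_def
proof (intro allI impI)
  fix r and s :: "nat \<Rightarrow> nat"
  assume "strict_mono_on {..<r} s" "s ` {..<r} \<subseteq> {..<n}"
  then have "strict_mono_on {..<r} (\<lambda>i. insert_index p (s i))"
    "(\<lambda>i. insert_index p (s i)) ` {..<r} \<subseteq> {..<Suc n}"
    by (fastforce simp: strict_mono_on_def insert_index_def)+
  then show "0 < mdet r (\<lambda>i j. f (insert_index p (s i)) (insert_index p (s j)))"
    using assms unfolding principal_minors_positive_def by blast
qed

text \<open>By linearity in each row, the determinant of \<open>diag s * f + diag t\<close> is a
  combination of principal minors of \<open>f\<close> with nonnegative weights. The proof replaces
  the rows one at a time.\<close>

lemma mdet_diagonal_mix_positive:
  assumes "principal_minors_positive n f"
    and "\<And>i. i < n \<Longrightarrow> 0 \<le> s i" "\<And>i. i < n \<Longrightarrow> 0 \<le> t i" "\<And>i. i < n \<Longrightarrow> 0 < s i + t i"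
  shows "0 < mdet n (\<lambda>i j. s i * f i j + (if i = j then t i else 0))"
  using assms
proof (induction n arbitrary: f s t)
  case (Suc n)
  \<comment> \<open>The first \<open>k\<close> rows of \<open>G k\<close> are already replaced.
    \<open>G k\<close> and \<open>G (Suc k)\<close> differ in row \<open>k\<close> only and share
    the cofactors of that row.\<close>
  define G where "G k = (\<lambda>i j. if i < k then s i * f i j + (if i = j then t i else 0) else f i j)" for k
  have "0 < mdet (Suc n) (G k)" if "k \<le> Suc n" for k
    using that
  proof (induction k)
    case 0
    have "strict_mono_on {..<Suc n} (\<lambda>i. i :: nat)" "(\<lambda>i. i) ` {..<Suc n} \<subseteq> {..<Suc n}"
      by (auto simp: strict_mono_on_def)
    then show ?case
      using Suc.prems(1) unfolding principal_minors_positive_def G_def by auto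
  next
    case step: (Suc k)
    then have k: "k < Suc n" by simp
    define C where "C H j = (-1) ^ (k + j) *
      mdet (Suc n - 1) (\<lambda>i' j'. H (insert_index k i') (insert_index j j'))"
      for H :: "nat \<Rightarrow> nat \<Rightarrow> real" and j
    have C_eq: "C (G (Suc k)) j = C (G k) j" for j
    proof -
      have "G (Suc k) (insert_index k i') = G k (insert_index k i')" for i'
        by (auto simp: G_def insert_index_def)
      then show ?thesis by (simp add: C_def)
    qed
    have "mdet (Suc n) (G (Suc k)) = (\<Sum>j<Suc n. G (Suc k) k j * C (G k) j)"
      using mdet_expand_row[OF k, of "G (Suc k)"] C_eq by (simp add: C_def)
    also have "\<dots> = (\<Sum>j<Suc n. s k * (G k k j * C (G k) j) + (if k = j then t k * C (G k) j else 0))"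
      by (intro sum.cong) (auto simp: G_def algebra_simps)
    also have "\<dots> = s k * (\<Sum>j<Suc n. G k k j * C (G k) j) + t k * C (G k) k"
      unfolding sum.distrib sum_distrib_left[symmetric] using k by (subst sum.delta') auto
    also have "(\<Sum>j<Suc n. G k k j * C (G k) j) = mdet (Suc n) (G k)"
      using mdet_expand_row[OF k, of "G k"] by (simp add: C_def)
    finally have eq: "mdet (Suc n) (G (Suc k)) = s k * mdet (Suc n) (G k) + t k * C (G k) k" .
    \<comment> \<open>The cofactor at \<open>(k, k)\<close> has the same mixed form on the principal
      submatrix omitting \<open>k\<close>, with weights 1 and 0 on the rows not yet
      replaced.\<close>
    have "0 < mdet n (\<lambda>i j. (if i < k then s i else 1) * f (insert_index k i) (insert_index k j)
        + (if i = j then (if i < k then t i else 0) else 0))"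
      by (rule Suc.IH[OF principal_minors_positive_delete])
        (use k Suc.prems in auto)
    also have "\<dots> = C (G k) k"
      unfolding C_def by (auto simp: G_def insert_index_def intro!: mdet_cong)
    finally have "0 < C (G k) k" .
    moreover have "0 < mdet (Suc n) (G k)" using step by simp
    moreover have "0 \<le> s k" "0 \<le> t k" "0 < s k + t k" using Suc.prems k by auto
    ultimately show ?case
      unfolding eq by (cases "s k = 0") (auto intro: add_pos_nonneg)
  qed
  from this[of "Suc n"] have "0 < mdet (Suc n) (G (Suc n))" by simp
  also have "mdet (Suc n) (G (Suc n)) =
      mdet (Suc n) (\<lambda>i j. s i * f i j + (if i = j then t i else 0))"
    by (rule mdet_cong) (simp add: G_def)
  finally show ?case .
qed simp

text \<open>The Fiedler-Ptak characterisation of P-matrices. In this form it passes to Schur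
  complements by extending the vector \<open>z\<close>.\<close>

definition sign_nonreversing :: "nat \<Rightarrow> (nat \<Rightarrow> nat \<Rightarrow> real) \<Rightarrow> bool" where
  "sign_nonreversing n f \<longleftrightarrow>
    (\<forall>z. (\<forall>i<n. z i * (\<Sum>j<n. f i j * z j) \<le> 0) \<longrightarrow> (\<forall>i<n. z i = 0))"

lemma sign_nonreversingD:
  assumes "sign_nonreversing n f" "\<And>i. i < n \<Longrightarrow> z i * (\<Sum>j<n. f i j * z j) \<le> 0" "i < n"
  shows "z i = 0"
  using assms unfolding sign_nonreversing_def by blast

text \<open>A vector \<open>z\<close> whose signs are reversed lies in the kernel of \<open>diag s \<cdot> f + diag t\<close>,
  where \<open>s\<close> is the indicator of the support of \<open>z\<close>.\<close>

lemma principal_minors_positive_imp_sign_nonreversing: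
  assumes "principal_minors_positive n f"
  shows "sign_nonreversing n f"
  unfolding sign_nonreversing_def
proof (intro allI impI)
  fix z i
  assume z: "\<forall>i<n. z i * (\<Sum>j<n. f i j * z j) \<le> 0" and i: "i < n"
  define y where "y i = (\<Sum>j<n. f i j * z j)" for i
  define s where "s i = (if z i = 0 then 0 else 1 :: real)" for i
  \<comment> \<open>On the support of \<open>z\<close> this gives
    \<open>y i + t i * z i = 0\<close>, with \<open>t i \<ge> 0\<close> because
    \<open>z i * y i \<le> 0\<close>. Off the support, \<open>t i = 1\<close> keeps
    \<open>s i + t i\<close> positive.\<close>
  define t where "t i = (if z i = 0 then 1 else - y i / z i)" for i
  have t: "0 \<le> t i" if "i < n" for i
  proof -
    have "z i * y i \<le> 0" using z that by (simp add: y_def)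
    then show ?thesis
      by (auto simp: t_def mult_le_0_iff divide_nonneg_neg divide_nonpos_pos divide_le_0_iff)
  qed
  have "0 < mdet n (\<lambda>i j. s i * f i j + (if i = j then t i else 0))"
    by (rule mdet_diagonal_mix_positive[OF assms])
      (auto simp: t s_def add_pos_nonneg, auto simp: t_def)
  then have "mdet n (\<lambda>i j. s i * f i j + (if i = j then t i else 0)) \<noteq> 0" by simp
  then show "z i = 0"
  proof (rule mdet_nonzero_kernel[OF _ _ i])
    fix i assume i: "i < n"
    have "(\<Sum>j<n. (s i * f i j + (if i = j then t i else 0)) * z j) =
      (\<Sum>j<n. s i * (f i j * z j) + (if i = j then t i * z j else 0))"
      by (intro sum.cong) (auto simp: algebra_simps)
    also have "\<dots> = s i * y i + t i * z i"
      unfolding sum.distrib sum_distrib_left[symmetric] y_def using i by (subst sum.delta') auto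
    also have "\<dots> = 0" by (simp add: s_def t_def)
    finally show "(\<Sum>j<n. (s i * f i j + (if i = j then t i else 0)) * z j) = 0" .
  qed
qed

subsection \<open>The linear complementarity problem\<close>

definition lcp_sol :: "nat \<Rightarrow> (nat \<Rightarrow> nat \<Rightarrow> real) \<Rightarrow> (nat \<Rightarrow> real) \<Rightarrow> (nat \<Rightarrow> real) \<Rightarrow> bool" where
  "lcp_sol n f q x \<longleftrightarrow> (\<forall>i<n. 0 \<le> x i \<and> 0 \<le> (\<Sum>j<n. f i j * x j) + q i \<and>
     x i * ((\<Sum>j<n. f i j * x j) + q i) = 0)"

lemma complementary_pairs_product:
  fixes a b y w :: real
  assumes "0 \<le> a" "0 \<le> b" "0 \<le> y" "0 \<le> w" "a * y = 0" "b * w = 0"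
  shows "(a - b) * (y - w) \<le> 0"
proof -
  have "(a - b) * (y - w) = a * y + b * w - a * w - b * y" by (simp add: algebra_simps)
  then show ?thesis using assms mult_nonneg_nonneg[of a w] mult_nonneg_nonneg[of b y] by linarith
qed

text \<open>\<open>q\<close> cancels in the difference of the slacks, so \<open>f\<close> maps
  \<open>x - x'\<close> to that difference. By complementarity \<open>x - x'\<close> has its signs
  reversed.\<close>

lemma lcp_sol_unique:
  assumes "sign_nonreversing n f" "lcp_sol n f q x" "lcp_sol n f q x'" "i < n"
  shows "x i = x' i"
proof -
  have "(x i - x' i) * (\<Sum>j<n. f i j * (x j - x' j)) \<le> 0" if "i < n" for i
  proof -
    have "(x i - x' i) * (((\<Sum>j<n. f i j * x j) + q i) - ((\<Sum>j<n. f i j * x' j) + q i)) \<le> 0"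
      using assms(2,3) that unfolding lcp_sol_def by (intro complementary_pairs_product) auto
    then show ?thesis by (simp add: right_diff_distrib sum_subtractf)
  qed
  from sign_nonreversingD[OF assms(1) this assms(4)] show ?thesis by simp
qed

text \<open>Solve the two subproblems with the last variable, respectively the last slack, forced to be
  zero. If neither solves the whole problem, their difference has its signs reversed.\<close>

lemma lcp_sol_exists:
  assumes "sign_nonreversing n f"
  shows "\<exists>x. lcp_sol n f q x"
  using assms
proof (induction n arbitrary: f q)
  case 0
  then show ?case by (simp add: lcp_sol_def)
next
  case (Suc n)
  note nonrev = sign_nonreversingD[OF Suc.prems]
  have "sign_nonreversing n f"
    unfolding sign_nonreversing_def
  proof (intro allI impI)
    fix z i
    assume z: "\<forall>i<n. z i * (\<Sum>j<n. f i j * z j) \<le> 0" and i: "i < n"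
    have "(z(n := 0)) i = 0"
      by (rule nonrev) (use z i in \<open>auto simp: less_Suc_eq\<close>)
    then show "z i = 0" using i by simp
  qed
  then obtain x where x: "lcp_sol n f q x" using Suc.IH by blast
  define u where "u = x(n := 0)"
  define yu where "yu i = (\<Sum>j<Suc n. f i j * u j) + q i" for i
  have u: "0 \<le> u i" "0 \<le> yu i" "u i * yu i = 0" if "i < n" for i
    using x that by (auto simp: lcp_sol_def u_def yu_def)
  have un: "u n = 0" by (simp add: u_def)
  \<comment> \<open>Otherwise the unit vector at \<open>n\<close> would have its sign
    reversed.\<close>
  have fnn: "0 < f n n"
  proof (rule ccontr)
    assume "\<not> 0 < f n n"
    then have "(\<lambda>i. if i = n then 1 else 0 :: real) n = 0"
      by (intro nonrev) (auto simp: if_distrib[where f = "\<lambda>x. _ * x"] sum.delta cong: if_cong)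
    then show False by simp
  qed
  \<comment> \<open>\<open>g\<close> is the Schur complement of \<open>f n n\<close>.
    \<open>last w b\<close> is the last coordinate for which row \<open>n\<close> with constant
    \<open>b\<close> gives \<open>0\<close>; with it, \<open>f\<close> acts on the other rows as
    \<open>g\<close>, up to a constant.\<close>
  define g where "g i j = f i j - f i n * f n j / f n n" for i j
  define last where "last w b = - (b + (\<Sum>j<n. f n j * w j)) / f n n" for w b
  have elim_n: "(\<Sum>j<Suc n. f n j * (w(n := last w b)) j) + b = 0" for w b
    using fnn by (simp add: last_def)
  have elim_i: "(\<Sum>j<Suc n. f i j * (w(n := last w b)) j) =
      (\<Sum>j<n. g i j * w j) - f i n * b / f n n" for i w b
  proof -
    have "(\<Sum>j<n. g i j * w j) = (\<Sum>j<n. f i j * w j) - f i n / f n n * (\<Sum>j<n. f n j * w j)"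
      by (simp add: g_def sum_distrib_left sum_subtractf[symmetric] algebra_simps)
    then show ?thesis using fnn by (simp add: last_def field_simps)
  qed
  have "sign_nonreversing n g"
    unfolding sign_nonreversing_def
  proof (intro allI impI)
    fix z i
    assume z: "\<forall>i<n. z i * (\<Sum>j<n. g i j * z j) \<le> 0" and i: "i < n"
    have "(z(n := last z 0)) i = 0"
    proof (rule nonrev)
      fix i assume "i < Suc n"
      then show "(z(n := last z 0)) i * (\<Sum>j<Suc n. f i j * (z(n := last z 0)) j) \<le> 0"
        using z elim_i[where b = 0] elim_n[where b = 0] by (cases "i = n") auto
    qed (use i in simp)
    then show "z i = 0" using i by simp
  qed
  then obtain w where w: "lcp_sol n g (\<lambda>i. q i - f i n * q n / f n n) w" using Suc.IH by blast
  define v where "v = w(n := last w (q n))"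
  define yv where "yv i = (\<Sum>j<Suc n. f i j * v j) + q i" for i
  have yv_eq: "yv i = (\<Sum>j<n. g i j * w j) + (q i - f i n * q n / f n n)" for i
    using elim_i[where b = "q n"] by (simp only: yv_def v_def)
  have v: "0 \<le> v i" "0 \<le> yv i" "v i * yv i = 0" if "i < n" for i
    using w that unfolding lcp_sol_def yv_eq by (auto simp: v_def)
  have yvn: "yv n = 0" using elim_n by (simp only: yv_def v_def)
  show ?case
  proof (rule ccontr)
    assume no: "\<not> ?case"
    have "lcp_sol (Suc n) f q u" if "0 \<le> yu n"
      unfolding lcp_sol_def yu_def[symmetric] using u un that by (simp add: less_Suc_eq)
    then have yun: "yu n < 0" using no by fastforce
    have "lcp_sol (Suc n) f q v" if "0 \<le> v n"
      unfolding lcp_sol_def yv_def[symmetric] using v yvn that by (simp add: less_Suc_eq)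
    then have vn: "v n < 0" using no by fastforce
    \<comment> \<open>Below \<open>n\<close> the pairs are complementary; at \<open>n\<close> the
      product is \<open>- v n * yu n < 0\<close>. So \<open>u - v\<close> has its signs reversed
      although its last entry is positive.\<close>
    have "(\<lambda>i. u i - v i) n = 0"
    proof (rule nonrev)
      fix i assume i: "i < Suc n"
      have eq: "(\<Sum>j<Suc n. f i j * (u j - v j)) = yu i - yv i"
        by (simp only: yu_def yv_def right_diff_distrib sum_subtractf add_diff_add diff_self add_0_right)
      show "(u i - v i) * (\<Sum>j<Suc n. f i j * (u j - v j)) \<le> 0"
      proof (cases "i = n")
        case True
        have "- v n * yu n \<le> 0"
          using yun vn by (intro mult_nonneg_nonpos) auto
        then show ?thesis unfolding eq unfolding True using un yvn by simp
      next
        case False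
        then have "i < n" using i by simp
        then show ?thesis unfolding eq using u v by (intro complementary_pairs_product) auto
      qed
    qed simp
    then show False using un vn by simp
  qed
qed

text \<open>Applying the adjugate to the alternating vector \<open>d = (1,-1,1,\<dots>)\<close> yields an alternating vector
  that the matrix maps to \<open>det f \<cdot> d\<close>. If the determinant is not positive, the positive and the
  negative part of this vector solve the same complementarity problem.\<close>

lemma mdet_positive_of_lcp_sol_unique:
  assumes n: "0 < n"
    and entries: "\<And>i j. i \<le> n \<Longrightarrow> j \<le> n \<Longrightarrow> 0 < f i j"
    and minors: "\<And>i j. i \<le> n \<Longrightarrow> j \<le> n \<Longrightarrow>
      0 < mdet n (\<lambda>i' j'. f (insert_index i i') (insert_index j j'))"
    and unique: "\<And>q x x'. (\<And>i. i \<le> n \<Longrightarrow> q i < 0) \<Longrightarrow> lcp_sol (Suc n) f q x \<Longrightarrow>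
      lcp_sol (Suc n) f q x' \<Longrightarrow> x 0 = x' 0"
  shows "0 < mdet (Suc n) f"
proof (rule ccontr)
  assume "\<not> 0 < mdet (Suc n) f"
  then have det: "mdet (Suc n) f \<le> 0" by simp
  define M where "M k j = mdet n (\<lambda>i' j'. f (insert_index k i') (insert_index j j'))" for k j
  \<comment> \<open>The signs of the cofactors and of \<open>d\<close> combine to
    \<open>(-1) ^ j\<close>: entry \<open>j\<close> of the adjugate applied to \<open>d\<close> is
    \<open>(-1) ^ j * S j\<close>. Its positive and negative parts are \<open>u\<close> and
    \<open>v\<close>.\<close>
  define S where "S j = (\<Sum>k<Suc n. M k j)" for j
  have S_pos: "0 < S j" if "j \<le> n" for j
    unfolding S_def by (rule sum_pos) (use minors that in \<open>auto simp: M_def\<close>)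
  define u where "u j = (if even j then S j else 0)" for j
  define v where "v j = (if odd j then S j else 0)" for j
  define F where "F x i = (\<Sum>j<Suc n. f i j * x j)" for x :: "nat \<Rightarrow> real" and i
  have diff: "F u i - F v i = (-1) ^ i * mdet (Suc n) f" if "i \<le> n" for i
  proof -
    have "F u i - F v i = (\<Sum>j<Suc n. f i j * ((-1) ^ j * S j))"
      unfolding F_def sum_subtractf[symmetric]
      by (intro sum.cong) (auto simp: u_def v_def)
    also have "\<dots> = (\<Sum>j<Suc n. \<Sum>k<Suc n. (-1) ^ k * (f i j * ((-1) ^ (k + j) * M k j)))"
      unfolding S_def sum_distrib_left by (intro sum.cong) (auto simp: power_add)
    also have "\<dots> = (\<Sum>k<Suc n. (-1) ^ k * (\<Sum>j<Suc n. f i j * ((-1) ^ (k + j) * M k j)))"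
      unfolding sum_distrib_left by (rule sum.swap)
    also have "\<dots> = (\<Sum>k<Suc n. (-1) ^ k * (if i = k then mdet (Suc n) f else 0))"
      using that mdet_adjugate[of i "Suc n" _ f]
      by (intro sum.cong) (auto simp: M_def)
    also have "\<dots> = (\<Sum>k<Suc n. if i = k then (-1) ^ k * mdet (Suc n) f else 0)"
      by (intro sum.cong) auto
    also have "\<dots> = (-1) ^ i * mdet (Suc n) f"
      using that by (subst sum.delta') auto
    finally show ?thesis .
  qed
  have F_pos: "0 < F x i" if "i \<le> n" "k \<le> n" "0 < x k" "\<And>j. j \<le> n \<Longrightarrow> 0 \<le> x j" for x i k
    unfolding F_def
    by (rule sum_pos2[where i = k]) (use that entries in \<open>auto simp: less_imp_le\<close>)
  have u_pos: "0 < F u i" if "i \<le> n" for i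
    by (rule F_pos[where k = 0]) (use that S_pos in \<open>auto simp: u_def less_imp_le\<close>)
  have v_pos: "0 < F v i" if "i \<le> n" for i
    by (rule F_pos[where k = 1]) (use that S_pos n in \<open>auto simp: v_def less_imp_le\<close>)
  \<comment> \<open>As the determinant is at most \<open>0\<close>, \<open>diff\<close> shows that
    this is minus the smaller of \<open>F u i\<close> and \<open>F v i\<close>. So the slack of
    \<open>u\<close> vanishes at even \<open>i\<close> and that of \<open>v\<close> at odd
    \<open>i\<close>, exactly where they are supported.\<close>
  define q where "q i = - (if even i then F u i else F v i)" for i
  have "u 0 = v 0"
  proof (rule unique)
    show "q i < 0" if "i \<le> n" for i
      using u_pos v_pos that by (simp add: q_def)
    show "lcp_sol (Suc n) f q u"
      unfolding lcp_sol_def F_def[symmetric]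
    proof (intro allI impI)
      fix i assume "i < Suc n"
      then have "i \<le> n" by simp
      then show "0 \<le> u i \<and> 0 \<le> F u i + q i \<and> u i * (F u i + q i) = 0"
        using S_pos[of i] diff[of i] det by (cases "even i") (simp_all add: u_def[of i] q_def)
    qed
    show "lcp_sol (Suc n) f q v"
      unfolding lcp_sol_def F_def[symmetric]
    proof (intro allI impI)
      fix i assume "i < Suc n"
      then have "i \<le> n" by simp
      then show "0 \<le> v i \<and> 0 \<le> F v i + q i \<and> v i * (F v i + q i) = 0"
        using S_pos[of i] diff[of i] det by (cases "even i") (simp_all add: v_def[of i] q_def)
    qed
  qed
  then show False using S_pos[of 0] by (simp add: u_def v_def)
qed

subsection \<open>Toeplitz matrices\<close>

lemma TP_Polya_frequency_seq_altdef:
  "TP_Polya_frequency_seq k c \<longleftrightarrow>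
     (\<forall>r \<in> {1..k}. \<forall>m n :: nat \<Rightarrow> int. strict_mono_on {..<r} m \<longrightarrow> strict_mono_on {..<r} n \<longrightarrow>
        0 < mdet r (\<lambda>i j. c (m i - n j)))"
  by (simp add: TP_Polya_frequency_seq_def mdet_def)

lemma TP_imp_unique_lcp_sol:
  fixes l :: int
  assumes TP: "TP_Polya_frequency_seq k c" and r: "r \<le> k"
  defines "f \<equiv> (\<lambda>i j. c (l + int i - int j))"
  shows "\<exists>x. lcp_sol r f q x"
    and "lcp_sol r f q x \<Longrightarrow> lcp_sol r f q x' \<Longrightarrow> i < r \<Longrightarrow> x i = x' i"
proof -
  have "principal_minors_positive r f"
    unfolding principal_minors_positive_def
  proof (intro allI impI)
    fix p and s :: "nat \<Rightarrow> nat"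
    assume s: "strict_mono_on {..<p} s" "s ` {..<p} \<subseteq> {..<r}"
    \<comment> \<open>Injectivity of \<open>s\<close> bounds the order \<open>p\<close> of the minor
      by \<open>r\<close>, hence by \<open>k\<close>.\<close>
    have "card (s ` {..<p}) = p"
      using strict_mono_on_imp_inj_on[OF s(1)] by (simp add: card_image)
    then have "p \<le> k" using card_mono[OF _ s(2)] r by simp
    moreover have "strict_mono_on {..<p} (\<lambda>i. l + int (s i))" "strict_mono_on {..<p} (\<lambda>i. int (s i))"
      using s(1) by (auto simp: strict_mono_on_def)
    ultimately show "0 < mdet p (\<lambda>i j. f (s i) (s j))"
      using TP unfolding TP_Polya_frequency_seq_altdef f_def by (cases "p = 0") auto
  qed
  then have nonrev: "sign_nonreversing r f"
    by (rule principal_minors_positive_imp_sign_nonreversing)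
  show "\<exists>x. lcp_sol r f q x" using nonrev by (rule lcp_sol_exists)
  show "lcp_sol r f q x \<Longrightarrow> lcp_sol r f q x' \<Longrightarrow> i < r \<Longrightarrow> x i = x' i"
    using nonrev by (rule lcp_sol_unique)
qed

text \<open>For \<open>r = 1\<close>, \<open>c l * x \<ge> 1\<close> with \<open>x \<ge> 0\<close>
  forces \<open>c l > 0\<close>. Uniqueness then drives an induction on the order; it compares
  coordinate \<open>0\<close>, where the two solutions built from a nonpositive minor
  differ.\<close>

lemma TP_of_unique_lcp_sol:
  assumes exists: "\<And>l. \<exists>x. lcp_sol 1 (\<lambda>i j. c (l + int i - int j)) (\<lambda>_. - 1) x"
    and unique: "\<And>r l q x x'. r \<in> {1..k} \<Longrightarrow> (\<And>i. i < r \<Longrightarrow> q i < 0) \<Longrightarrow>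
      lcp_sol r (\<lambda>i j. c (l + int i - int j)) q x \<Longrightarrow>
      lcp_sol r (\<lambda>i j. c (l + int i - int j)) q x' \<Longrightarrow> x 0 = x' 0"
  shows "TP_Polya_frequency_seq k c"
proof -
  have entries: "0 < c l" for l
  proof -
    obtain x where "0 \<le> x 0" "1 \<le> c l * x (0 :: nat)"
      using exists[of l] by (auto simp: lcp_sol_def)
    then show ?thesis by (smt (verit) mult_nonpos_nonneg)
  qed
  have "\<forall>m n :: nat \<Rightarrow> int. strict_mono_on {..<r} m \<longrightarrow> strict_mono_on {..<r} n \<longrightarrow>
      0 < mdet r (\<lambda>i j. c (m i - n j))" if "r \<le> k" for r
    using that
  proof (induction r)
    case (Suc r)
    then have IH: "0 < mdet r (\<lambda>i j. c (m i - n j))"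
      if "strict_mono_on {..<r} m" "strict_mono_on {..<r} n" for m n :: "nat \<Rightarrow> int"
      using that by simp
    \<comment> \<open>A contiguous submatrix is Toeplitz with offset \<open>a - b\<close>. Order 1
      is separate: the adjugate argument needs an odd index to make \<open>v\<close>
      nonzero.\<close>
    have contig: "0 < mdet (Suc r) (\<lambda>i j. c ((a + int i) - (b + int j)))" for a b
    proof (cases "r = 0")
      case True
      then show ?thesis using entries by (simp add: mdet_1)
    next
      case False
      have "0 < mdet (Suc r) (\<lambda>i j. c (a - b + int i - int j))"
      proof (rule mdet_positive_of_lcp_sol_unique)
        show "0 < mdet r (\<lambda>i' j'. c (a - b + int (insert_index i i') - int (insert_index j j')))"
          for i j
          by (rule IH) (auto simp: strict_mono_on_def insert_index_def)
        show "x 0 = x' 0" if "\<And>i. i \<le> r \<Longrightarrow> q i < 0"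
          "lcp_sol (Suc r) (\<lambda>i j. c (a - b + int i - int j)) q x"
          "lcp_sol (Suc r) (\<lambda>i j. c (a - b + int i - int j)) q x'" for q x x'
          by (rule unique[OF _ _ that(2,3)]) (use Suc.prems that(1) in auto)
      qed (use False entries in auto)
      moreover have "(a + int i) - (b + int j) = a - b + int i - int j" for i j by simp
      ultimately show ?thesis by (simp only:)
    qed
    show ?case
    proof (intro allI impI)
      fix m n :: "nat \<Rightarrow> int"
      assume m: "strict_mono_on {..<Suc r} m" and n: "strict_mono_on {..<Suc r} n"
      show "0 < mdet (Suc r) (\<lambda>i j. c (m i - n j))"
        by (rule Fekete_step[where g = "\<lambda>x y. c (x - y)", OF _ contig m n]) (rule IH)
    qed
  qed simp
  then show ?thesis unfolding TP_Polya_frequency_seq_altdef by auto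
qed

section \<open>Translation between one-based and zero-based indices\<close>

lemma lcp_sol_one_based:
  assumes "x \<in> {1..r} \<rightarrow>\<^sub>E {0::real..}"
  shows "(let y = (\<lambda>i. (\<Sum>j=1..r. c (l + int i - int j) * x j) + q i)
          in \<forall>i \<in> {1..r}. y i \<ge> 0 \<and> x i * y i = 0) \<longleftrightarrow>
    lcp_sol r (\<lambda>i j. c (l + int i - int j)) (\<lambda>i. q (Suc i)) (\<lambda>i. x (Suc i))"
proof -
  have "{1..r} = Suc ` {..<r}" by (simp add: image_Suc_lessThan)
  then have all: "(\<forall>i \<in> {1..r}. P i) \<longleftrightarrow> (\<forall>i<r. P (Suc i))" for P by auto
  have "0 \<le> x (Suc i)" if "i < r" for i
    using assms that by (auto simp: PiE_def Pi_def)
  then show ?thesis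
    unfolding Let_def all lcp_sol_def by (simp add: sum.atLeast1_atMost_eq add_diff_eq)
qed

theorem corollary1p2:
  fixes k :: nat and c :: "int \<Rightarrow> real"
  assumes "k \<ge> 1"
  shows "TP_Polya_frequency_seq k c \<longleftrightarrow>
    (\<forall>r \<in> {1..k}. \<forall>l :: int. \<forall>q \<in> {1..r} \<rightarrow>\<^sub>E {..<0::real}.
       \<exists>!x. x \<in> {1..r} \<rightarrow>\<^sub>E {0::real..} \<and>
         (let y = (\<lambda>i. (\<Sum>j=1..r. c (l + int i - int j) * x j) + q i)
          in \<forall>i \<in> {1..r}. y i \<ge> 0 \<and> x i * y i = 0))"
  (is "?TP \<longleftrightarrow> (\<forall>r \<in> {1..k}. \<forall>l. \<forall>q \<in> ?Q r. \<exists>!x. x \<in> ?X r \<and> ?sol r l q x)")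
proof
  let ?f = "\<lambda>l i j. c (l + int i - int j)"
  \<comment> \<open>Restricting to \<open>{1..r}\<close> makes the shifted vector extensional, so
    that uniqueness in \<open>?X r\<close> is equality of functions.\<close>
  define shift where "shift r x = restrict (\<lambda>i. x (i - 1)) {1..r}"
    for r and x :: "nat \<Rightarrow> real"
  have shift_Suc: "shift r x (Suc i) = x i" if "i < r" for r x i
    using that by (simp add: shift_def)
  have sum_shift: "(\<Sum>j<r. d j * shift r x (Suc j)) = (\<Sum>j<r. d j * x j)"
    for r x and d :: "nat \<Rightarrow> real"
    by (intro sum.cong) (auto simp: shift_Suc)
  have lcp_shift: "lcp_sol r a (\<lambda>i. shift r q (Suc i)) (\<lambda>i. shift r x (Suc i)) = lcp_sol r a q x"
    for r a q x
    unfolding lcp_sol_def by (simp add: shift_Suc sum_shift)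
  have shift_X: "shift r x \<in> ?X r" if "lcp_sol r a q x" for r a q x
    using that by (auto simp: shift_def lcp_sol_def)
  {
    assume TP: ?TP
    show "\<forall>r \<in> {1..k}. \<forall>l. \<forall>q \<in> ?Q r. \<exists>!x. x \<in> ?X r \<and> ?sol r l q x"
    proof (intro ballI allI)
      fix r l q
      assume r: "r \<in> {1..k}"
      then have "r \<le> k" by simp
      note sols = TP_imp_unique_lcp_sol[OF TP this, of l]
      obtain x where x: "lcp_sol r (?f l) (\<lambda>i. q (Suc i)) x" using sols(1) by blast
      show "\<exists>!x. x \<in> ?X r \<and> ?sol r l q x"
      proof (rule ex_ex1I)
        have "lcp_sol r (?f l) (\<lambda>i. q (Suc i)) (\<lambda>i. shift r x (Suc i))"
          using x unfolding lcp_sol_def by (simp add: shift_Suc sum_shift)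
        then show "\<exists>x. x \<in> ?X r \<and> ?sol r l q x"
          using shift_X[OF x] lcp_sol_one_based by blast
      next
        fix x x'
        assume x: "x \<in> ?X r \<and> ?sol r l q x" and x': "x' \<in> ?X r \<and> ?sol r l q x'"
        have "x (Suc i) = x' (Suc i)" if "i < r" for i
          using sols(2)[OF _ _ that] x x' lcp_sol_one_based by blast
        then have "x i = x' i" if "i \<in> {1..r}" for i
          using that by (cases i) auto
        with x x' show "x = x'" by (metis (no_types, lifting) PiE_ext)
      qed
    qed
  }
  {
    assume H: "\<forall>r \<in> {1..k}. \<forall>l. \<forall>q \<in> ?Q r. \<exists>!x. x \<in> ?X r \<and> ?sol r l q x"
    have solvable: "\<exists>!x. x \<in> ?X r \<and> ?sol r l q x" if "r \<in> {1..k}" "q \<in> ?Q r" for r q l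
      by (rule H[rule_format, OF that])
    have shift_Q: "shift r q \<in> ?Q r" if "\<And>i. i < r \<Longrightarrow> q i < 0" for r q
      using that by (auto simp: shift_def)
    show ?TP
    proof (rule TP_of_unique_lcp_sol)
      fix l
      have "shift 1 (\<lambda>_. -1) \<in> ?Q 1" by (rule shift_Q) simp
      then obtain x where "x \<in> ?X 1" "?sol 1 l (shift 1 (\<lambda>_. -1)) x"
        using solvable[of 1 "shift 1 (\<lambda>_. -1)" l] assms by auto
      then have "lcp_sol 1 (?f l) (\<lambda>i. shift 1 (\<lambda>_. -1) (Suc i)) (\<lambda>i. x (Suc i))"
        using lcp_sol_one_based by blast
      then show "\<exists>x. lcp_sol 1 (?f l) (\<lambda>_. - 1) x"
        by (auto simp: lcp_sol_def shift_Suc)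
    next
      fix r l q x x'
      assume r: "r \<in> {1..k}" and q: "\<And>i. i < r \<Longrightarrow> q i < 0"
        and x: "lcp_sol r (?f l) q x" "lcp_sol r (?f l) q x'"
      \<comment> \<open>Both shifted vectors solve the same one-based problem, whose uniqueness
        identifies them.\<close>
      have "?sol r l (shift r q) (shift r x)" "?sol r l (shift r q) (shift r x')"
        using x lcp_shift lcp_sol_one_based[OF shift_X[OF x(1)]]
          lcp_sol_one_based[OF shift_X[OF x(2)]] by blast+
      moreover have "\<exists>!x. x \<in> ?X r \<and> ?sol r l (shift r q) x"
        by (rule solvable[OF r shift_Q[OF q]])
      ultimately have "shift r x = shift r x'"
        using shift_X[OF x(1)] shift_X[OF x(2)] by blast
      then show "x 0 = x' 0" using r shift_Suc[of 0 r] by (metis atLeastAtMost_iff less_eq_Suc_le One_nat_def)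
    qed
  }
qed

end
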